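(* Let $n\ge 0$ and let $\lambda_1,\lambda_2,\ldots,\lambda_{n+1}$ be pairwise distinct (complex) values. Then $$\sum_{k=1}^{n+1}\frac{\lambda_k^{\mu}}{\prod_{j\neq k}(\lambda_k-\lambda_j)}=\begin{cases}0 & \text{if } 0\le\mu\le n-1,\\ 1 & \text{if }\mu=n,\end{cases}$$ where $\mu$ is an integer and the product runs over $j\in\{1,\ldots,n+1\}\setminus\{k\}$.
   Context: The convention $\lambda^0=1$ (also for $\lambda=0$) is used, and an empty product is $1$. *)

theory Defs
  imports Complex_Main
begin

end

theory Submission
  imports Defs "HOL-Computational_Algebra.Polynomial"
begin

text \<open>
  Lagrange interpolation at the nodes \<open>\<lambda>\<^sub>k\<close> reproduces every polynomial \<open>p\<close> of degree at most \<open>n\<close>.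
  The basis numerators are monic of degree \<open>n\<close>, so comparing the coefficients of \<open>x\<^sup>n\<close> shows that the
  sum of \<open>p(\<lambda>\<^sub>k) / \<Prod>\<^sub>j (\<lambda>\<^sub>k - \<lambda>\<^sub>j)\<close> is the coefficient of \<open>x\<^sup>n\<close> in \<open>p\<close>. Take \<open>p = x\<^sup>\<mu>\<close>.
\<close>

lemma sum_poly_div_prod_diff:
  fixes l :: "'i \<Rightarrow> 'a :: field"
  assumes inj: "inj_on l A" and card: "card A = Suc n" and deg: "degree p \<le> n"
  shows "(\<Sum>k\<in>A. poly p (l k) / (\<Prod>j\<in>A - {k}. l k - l j)) = coeff p n"
proof -
  have fin: "finite A"
    using card by (metis card.infinite nat.distinct(1))
  define w where "w k = (\<Prod>j\<in>A - {k}. l k - l j)" for k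
  define B where "B k = (\<Prod>j\<in>A - {k}. [:- l j, 1:])" for k
  \<comment> \<open>The Lagrange interpolant of \<open>p\<close> at the nodes
    \<open>l k\<close>.\<close>
  define q where "q = (\<Sum>k\<in>A. smult (poly p (l k) / w k) (B k))"
  have w_nz: "w k \<noteq> 0" if "k \<in> A" for k
    using that inj fin by (auto simp: w_def inj_on_def)
  have deg_B: "degree (B k) = n" if "k \<in> A" for k
    using that card fin unfolding B_def by (subst degree_prod_sum_eq) auto
  have coeff_B: "coeff (B k) n = 1" if "k \<in> A" for k
    using lead_coeff_prod[of "\<lambda>j. [:- l j, 1:]" "A - {k}"] deg_B[OF that] by (simp add: B_def)
  \<comment> \<open>For \<open>i \<noteq> k\<close> the factor with \<open>j = i\<close> vanishes at
    \<open>l i\<close>.\<close>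
  have poly_B: "poly (B k) (l i) = (if i = k then w k else 0)" if "k \<in> A" "i \<in> A" for k i
    using that fin by (auto simp: B_def w_def poly_prod)
  have "poly p x = poly q x" if x: "x \<in> l ` A" for x
  proof -
    from x obtain i where i: "i \<in> A" "x = l i" by blast
    have "poly q x = (\<Sum>k\<in>A. if i = k then poly p (l k) else 0)"
      unfolding q_def poly_sum using i by (intro sum.cong) (auto simp: poly_B w_nz)
    then show ?thesis
      using i fin by simp
  qed
  moreover have "degree q \<le> n"
    unfolding q_def using fin deg_B by (intro degree_sum_le) (auto intro: order_trans[OF degree_smult_le])
  moreover have "card (l ` A) = Suc n"
    using card_image[OF inj] card by simp
  \<comment> \<open>Two polynomials of degree at most \<open>n\<close> that agree at
    \<open>Suc n\<close> distinct points are equal.\<close>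
  ultimately have "p = q"
    using deg by (intro poly_eqI_degree[of "l ` A"]) auto
  moreover have "coeff q n = (\<Sum>k\<in>A. poly p (l k) / w k)"
    unfolding q_def coeff_sum by (intro sum.cong) (auto simp: coeff_B)
  ultimately show ?thesis
    by (simp add: w_def)
qed

theorem theoremB1:
  fixes n :: nat and \<mu> :: nat and l :: "nat \<Rightarrow> complex"
  assumes distinct: "inj_on l {1..n+1}"
  shows "(\<mu> < n \<longrightarrow>
            (\<Sum>k=1..n+1. l k ^ \<mu> / (\<Prod>j\<in>{1..n+1} - {k}. l k - l j)) = 0) \<and>
         (\<mu> = n \<longrightarrow>
            (\<Sum>k=1..n+1. l k ^ \<mu> / (\<Prod>j\<in>{1..n+1} - {k}. l k - l j)) = 1)"
  \<comment> \<open>Both cases satisfy the degree bound \<open>\<mu> \<le> n\<close>; the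
    coefficient of \<open>monom 1 \<mu>\<close> at \<open>n\<close> is 1 if \<open>\<mu> = n\<close>
    and 0 if \<open>\<mu> < n\<close>.\<close>
  using sum_poly_div_prod_diff[OF distinct, of n "monom 1 \<mu>"]
  by (auto simp: poly_monom degree_monom_eq)

end
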